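(* Let $m\ge 2$ and let $v,w\in(R_\infty)^m$, where $R_\infty=(\mathbb{Z},* )$ with $a*b=2b-a$. The following are equivalent. (1) There exists a virtual $m$-braid $\beta\in VB_m$ such that $v\cdot\beta=w$. (2) $d(v)=d(w)$ and $M(v)=M(w)$.
   Context: The universal dihedral quandle $R_\infty$ is the set $\mathbb{Z}$ with operation $a*b=2b-a$; thus $(R_\infty)^m=\mathbb{Z}^m$ as a set. $VB_m$ is the virtual $m$-braid group with standard generators $\sigma_1,\dots,\sigma_{m-1}$ (classical crossings) and $\tau_1,\dots,\tau_{m-1}$ (virtual crossings), subject to the braid relations for the $\sigma_i$, the symmetric group relations for the $\tau_i$ (in particular $\tau_i^2=1$), and the mixed relations $\sigma_i\tau_j=\tau_j\sigma_i$ for $|i-j|\ge2$ and $\tau_i\tau_{i+1}\sigma_i=\sigma_{i+1}\tau_i\tau_{i+1}$. The Hurwitz action is the right action of $VB_m$ on $\mathbb{Z}^m$ given by $(a_1,\dots,a_m)\cdot\sigma_i=(a_1,\dots,a_{i-1},a_{i+1},2a_{i+1}-a_i,a_{i+2},\dots,a_m)$ and $(a_1,\dots,a_m)\cdot\tau_i=(a_1,\dots,a_{i-1},a_{i+1},a_i,a_{i+2},\dots,a_m)$. For $v=(a_1,\dots,a_m)\in\mathbb{Z}^m$: $v$ is trivial if $a_1=\dots=a_m$, and nontrivial otherwise. $d(v)=0$ if $v$ is trivial, and $d(v)=\gcd\{a_i-a_j\mid 1\le i,j\le m\}>0$ if $v$ is nontrivial. $M(v)$ is the multiset (unordered $m$-tuple)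 of the congruence classes of $a_1,\dots,a_m$ modulo $2d(v)$, with the convention that if $d(v)=0$, the class of $a_i$ is the integer $a_i$ itself. *)

theory Defs
  imports "HOL-Algebra.Group" "HOL-Library.Multiset" "HOL-Number_Theory.Cong"
begin

section \<open>Groups given by generators and relations\<close>

text \<open>A letter is a generator together with a flag saying whether its formal inverse is meant.\<close>

type_synonym 'g word = "('g \<times> bool) list"

definition words :: "'g set \<Rightarrow> 'g word set"
  where "words X = lists (X \<times> UNIV)"

text \<open>The congruence generated by the relators \<open>R\<close> (pairs of words declared equal) and by the
  free cancellations.\<close>

inductive pres_eq :: "'g set \<Rightarrow> ('g word \<times> 'g word) set \<Rightarrow> 'g word \<Rightarrow> 'g word \<Rightarrow> bool"
  for X :: "'g set" and R :: "('g word \<times> 'g word) set" where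
  refl: "u \<in> words X \<Longrightarrow> pres_eq X R u u"
| sym: "pres_eq X R u v \<Longrightarrow> pres_eq X R v u"
| trans: "pres_eq X R u v \<Longrightarrow> pres_eq X R v w \<Longrightarrow> pres_eq X R u w"
| rel: "(u, v) \<in> R \<Longrightarrow> u \<in> words X \<Longrightarrow> v \<in> words X \<Longrightarrow> pres_eq X R u v"
| cancel: "x \<in> X \<Longrightarrow> pres_eq X R [(x, b), (x, \<not> b)] []"
| append: "pres_eq X R u u' \<Longrightarrow> pres_eq X R v v' \<Longrightarrow> pres_eq X R (u @ v) (u' @ v')"

definition pres_rel :: "'g set \<Rightarrow> ('g word \<times> 'g word) set \<Rightarrow> ('g word \<times> 'g word) set"
  where "pres_rel X R = {(u, v). pres_eq X R u v}"

definition presented_group :: "'g set \<Rightarrow> ('g word \<times> 'g word) set \<Rightarrow> 'g word set monoid"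
  where "presented_group X R =
    \<lparr>carrier = words X // pres_rel X R,
     monoid.mult = (\<lambda>A B. \<Union>u\<in>A. \<Union>v\<in>B. pres_rel X R `` {u @ v}),
     one = pres_rel X R `` {[]}\<rparr>"

lemma words_simps [simp]:
  "[] \<in> words X" "(a # u) \<in> words X \<longleftrightarrow> fst a \<in> X \<and> u \<in> words X"
  "u @ v \<in> words X \<longleftrightarrow> u \<in> words X \<and> v \<in> words X"
  by (cases a; auto simp: words_def)+

lemma pres_eq_words: "pres_eq X R u v \<Longrightarrow> u \<in> words X \<and> v \<in> words X"
  by (induction rule: pres_eq.induct) auto

lemma equiv_pres_rel: "equiv (words X) (pres_rel X R)"
proof (rule equivI)
  show "pres_rel X R \<subseteq> words X \<times> words X"
    unfolding pres_rel_def by (blast dest: pres_eq_words)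
  show "refl_on (words X) (pres_rel X R)"
    by (simp add: refl_on_def pres_rel_def pres_eq.refl)
  show "Relation.sym (pres_rel X R)"
    unfolding sym_def pres_rel_def by (blast intro: pres_eq.sym)
  show "Relation.trans (pres_rel X R)"
    unfolding trans_def pres_rel_def by (blast intro: pres_eq.trans)
qed

lemma presented_mult:
  assumes "u \<in> words X" "v \<in> words X"
  shows "(pres_rel X R `` {u}) \<otimes>\<^bsub>presented_group X R\<^esub> (pres_rel X R `` {v}) = pres_rel X R `` {u @ v}"
proof -
  have "pres_rel X R `` {u' @ v'} = pres_rel X R `` {u @ v}"
    if "u' \<in> pres_rel X R `` {u}" "v' \<in> pres_rel X R `` {v}" for u' v'
  proof -
    have "(u @ v, u' @ v') \<in> pres_rel X R"
      using that by (simp add: pres_rel_def pres_eq.append)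
    then show ?thesis
      by (rule equiv_class_eq[OF equiv_pres_rel, symmetric])
  qed
  then have "(\<Union>u'\<in>pres_rel X R `` {u}. \<Union>v'\<in>pres_rel X R `` {v}. pres_rel X R `` {u' @ v'})
      = (\<Union>u'\<in>pres_rel X R `` {u}. \<Union>v'\<in>pres_rel X R `` {v}. pres_rel X R `` {u @ v})"
    by (intro SUP_cong HOL.refl)
  moreover have "u \<in> pres_rel X R `` {u}" "v \<in> pres_rel X R `` {v}"
    using assms by (simp_all add: pres_rel_def pres_eq.refl)
  ultimately show ?thesis
    by (simp add: presented_group_def) blast
qed

lemma inverse_letters:
  assumes "u \<in> words X"
  shows "\<exists>u' \<in> words X. pres_eq X R (u' @ u) []"
  using assms
proof (induction u)
  case Nil
  show ?case
    by (rule bexI[of _ "[]"]) (simp_all add: pres_eq.refl)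
next
  case (Cons a u)
  obtain x b where a: "a = (x, b)" by (cases a)
  from Cons obtain u' where u': "u' \<in> words X" "pres_eq X R (u' @ u) []" by auto
  have x: "x \<in> X" and u: "u \<in> words X" using Cons.prems a by auto
  have "pres_eq X R ([(x, \<not> b), (x, b)]) []"
    using pres_eq.cancel[OF x, of R "\<not> b"] by simp
  then have "pres_eq X R ([(x, \<not> b), (x, b)] @ u) ([] @ u)"
    by (rule pres_eq.append) (rule pres_eq.refl[OF u])
  then have "pres_eq X R (u' @ ([(x, \<not> b), (x, b)] @ u)) (u' @ ([] @ u))"
    by (rule pres_eq.append[OF pres_eq.refl[OF u'(1)]])
  from pres_eq.trans[OF this] have "pres_eq X R ((u' @ [(x, \<not> b)]) @ a # u) []"
    using u' a by simp
  then show ?case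
    using u' x by (intro bexI[of _ "u' @ [(x, \<not> b)]"]) auto
qed

lemma group_presented_group: "group (presented_group X R)"
proof -
  let ?G = "presented_group X R" and ?C = "\<lambda>u. pres_rel X R `` {u}"
  have carr: "carrier ?G = ?C ` words X"
    by (auto simp: presented_group_def quotient_def)
  have one: "\<one>\<^bsub>?G\<^esub> = ?C []"
    by (simp add: presented_group_def)
  have closed: "?C u \<in> carrier ?G" if "u \<in> words X" for u
    using that by (simp add: carr)
  have reps: "\<exists>u \<in> words X. A = ?C u" if "A \<in> carrier ?G" for A
    using that by (auto simp: carr)
  show ?thesis
  proof (rule groupI)
    show "\<one>\<^bsub>?G\<^esub> \<in> carrier ?G"
      unfolding one by (rule closed) simp
  next
    fix A B assume "A \<in> carrier ?G" "B \<in> carrier ?G"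
    then obtain u v where uv: "u \<in> words X" "A = ?C u" "v \<in> words X" "B = ?C v"
      using reps by meson
    then show "A \<otimes>\<^bsub>?G\<^esub> B \<in> carrier ?G"
      using closed[of "u @ v"] by (simp add: presented_mult)
    fix D assume "D \<in> carrier ?G"
    then obtain w where "w \<in> words X" "D = ?C w"
      using reps by meson
    with uv show "A \<otimes>\<^bsub>?G\<^esub> B \<otimes>\<^bsub>?G\<^esub> D = A \<otimes>\<^bsub>?G\<^esub> (B \<otimes>\<^bsub>?G\<^esub> D)"
      by (simp add: presented_mult)
  next
    fix A assume "A \<in> carrier ?G"
    then obtain u where u: "u \<in> words X" "A = ?C u" using reps by meson
    then show "\<one>\<^bsub>?G\<^esub> \<otimes>\<^bsub>?G\<^esub> A = A"
      by (simp add: presented_mult one)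
    obtain u' where u': "u' \<in> words X" "pres_eq X R (u' @ u) []"
      using inverse_letters[OF u(1)] by blast
    have "?C (u' @ u) = ?C []"
      using u' by (intro equiv_class_eq[OF equiv_pres_rel]) (simp add: pres_rel_def)
    then have "?C u' \<otimes>\<^bsub>?G\<^esub> A = \<one>\<^bsub>?G\<^esub>"
      using u u' by (simp add: presented_mult one)
    then show "\<exists>B\<in>carrier ?G. B \<otimes>\<^bsub>?G\<^esub> A = \<one>\<^bsub>?G\<^esub>"
      using closed[OF u'(1)] by blast
  qed
qed


section \<open>The virtual braid group\<close>

datatype vgen = Sigma_gen nat | Tau_gen nat

abbreviation \<sigma> :: "nat \<Rightarrow> vgen \<times> bool" where "\<sigma> i \<equiv> (Sigma_gen i, False)"
abbreviation \<tau> :: "nat \<Rightarrow> vgen \<times> bool" where "\<tau> i \<equiv> (Tau_gen i, False)"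

definition VB_gens :: "nat \<Rightarrow> vgen set"
  where "VB_gens m = Sigma_gen ` {1..<m} \<union> Tau_gen ` {1..<m}"

text \<open>In the far commutations \<open>i\<close> and \<open>j\<close> range over both orders.\<close>

definition VB_rels :: "nat \<Rightarrow> (vgen word \<times> vgen word) set"
  where "VB_rels m =
      {([\<sigma> i, \<sigma> (i+1), \<sigma> i], [\<sigma> (i+1), \<sigma> i, \<sigma> (i+1)]) | i. 1 \<le> i \<and> i + 1 < m}
    \<union> {([\<sigma> i, \<sigma> j], [\<sigma> j, \<sigma> i]) | i j. i \<in> {1..<m} \<and> j \<in> {1..<m} \<and> (i + 2 \<le> j \<or> j + 2 \<le> i)}
    \<union> {([\<tau> i, \<tau> i], []) | i. i \<in> {1..<m}}
    \<union> {([\<tau> i, \<tau> (i+1), \<tau> i], [\<tau> (i+1), \<tau> i, \<tau> (i+1)]) | i. 1 \<le> i \<and> i + 1 < m}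
    \<union> {([\<tau> i, \<tau> j], [\<tau> j, \<tau> i]) | i j. i \<in> {1..<m} \<and> j \<in> {1..<m} \<and> (i + 2 \<le> j \<or> j + 2 \<le> i)}
    \<union> {([\<sigma> i, \<tau> j], [\<tau> j, \<sigma> i]) | i j. i \<in> {1..<m} \<and> j \<in> {1..<m} \<and> (i + 2 \<le> j \<or> j + 2 \<le> i)}
    \<union> {([\<tau> i, \<tau> (i+1), \<sigma> i], [\<sigma> (i+1), \<tau> i, \<tau> (i+1)]) | i. 1 \<le> i \<and> i + 1 < m}"

definition VB :: "nat \<Rightarrow> vgen word set monoid"
  where "VB m = presented_group (VB_gens m) (VB_rels m)"

lemma group_VB: "group (VB m)"
  unfolding VB_def by (rule group_presented_group)


section \<open>The Hurwitz action\<close>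

definition rinf_op :: "int \<Rightarrow> int \<Rightarrow> int"  (infixl "\<rhd>" 70)
  where "a \<rhd> b = 2 * b - a"

text \<open>The tuple \<open>(a\<^sub>1, \<dots>, a\<^sub>m)\<close> is a list of length \<open>m\<close>; lists being indexed from 0, the entry
  \<open>a\<^sub>i\<close> is \<open>v ! (i - 1)\<close>. The inverse of \<open>(a, b) \<mapsto> (b, a \<rhd> b)\<close> is \<open>(x, y) \<mapsto> (y \<rhd> x, x)\<close>,
  since \<open>(a \<rhd> b) \<rhd> b = a\<close>.\<close>

fun letter_act :: "int list \<Rightarrow> vgen \<times> bool \<Rightarrow> int list" where
  "letter_act v (Sigma_gen i, False) = v[i - 1 := v ! i, i := v ! (i - 1) \<rhd> v ! i]"
| "letter_act v (Sigma_gen i, True) = v[i - 1 := v ! i \<rhd> v ! (i - 1), i := v ! (i - 1)]"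
| "letter_act v (Tau_gen i, b) = v[i - 1 := v ! i, i := v ! (i - 1)]"

definition word_act :: "int list \<Rightarrow> vgen word \<Rightarrow> int list"
  where "word_act v u = foldl letter_act v u"

text \<open>An element of \<open>VB m\<close> is a class of words, all of which act in the same way on tuples of
  length \<open>m\<close> (lemma \<open>hurwitz_act_class\<close>).\<close>

definition hurwitz_act :: "int list \<Rightarrow> vgen word set \<Rightarrow> int list"  (infixl "\<cdot>" 70)
  where "v \<cdot> \<beta> = the_elem (word_act v ` \<beta>)"

lemma length_letter_act [simp]: "length (letter_act v a) = length v"
  by (cases "(v, a)" rule: letter_act.cases) auto

lemma length_word_act [simp]: "length (word_act v u) = length v"
  by (induction u arbitrary: v) (auto simp: word_act_def)

lemma word_act_append: "word_act v (u @ u') = word_act (word_act v u) u'"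
  by (simp add: word_act_def)

lemma split2:
  assumes "1 \<le> i" "i < length v"
  shows "\<exists>xs a b ys. v = xs @ a # b # ys \<and> i = Suc (length xs)"
proof -
  have "v = take (i - 1) v @ v ! (i - 1) # v ! i # drop (Suc i) v"
    using assms id_take_nth_drop[of "i - 1" v] Cons_nth_drop_Suc[of i v] by simp
  moreover have "i = Suc (length (take (i - 1) v))"
    using assms by simp
  ultimately show ?thesis by blast
qed

lemma split3:
  assumes "1 \<le> i" "i + 1 < length v"
  shows "\<exists>xs a b c ys. v = xs @ a # b # c # ys \<and> i = Suc (length xs)"
proof -
  have "i < length v" using assms by simp
  with split2[OF assms(1)] obtain xs a b zs where v: "v = xs @ a # b # zs" "i = Suc (length xs)"
    by blast
  with assms obtain c ys where "zs = c # ys" by (cases zs) simp_all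
  with v show ?thesis by blast
qed

lemma split4:
  assumes "1 \<le> i" "i + 2 \<le> j" "j < length v"
  shows "\<exists>xs a b ys c d zs. v = xs @ a # b # ys @ c # d # zs \<and>
    i = Suc (length xs) \<and> j = Suc (Suc (Suc (length xs + length ys)))"
proof -
  have "i < length v" using assms by simp
  with split2[OF assms(1)] obtain xs a b us where v: "v = xs @ a # b # us" "i = Suc (length xs)"
    by blast
  have "1 \<le> j - Suc i" "j - Suc i < length us" using v assms by simp_all
  from split2[OF this] obtain ys c d zs
    where us: "us = ys @ c # d # zs" "j - Suc i = Suc (length ys)" by blast
  have "j = Suc (Suc (Suc (length xs + length ys)))"
    using us v assms by simp
  with v us show ?thesis by blast
qed

lemma word_act_cancel:
  assumes "x \<in> VB_gens (length v)"
  shows "word_act v [(x, b), (x, \<not> b)] = v"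
proof -
  obtain i where i: "1 \<le> i" "i < length v" "x = Sigma_gen i \<or> x = Tau_gen i"
    using assms by (auto simp: VB_gens_def)
  then obtain xs c d ys where v: "v = xs @ c # d # ys" "i = Suc (length xs)"
    using split2 by blast
  from i(3) show ?thesis
    unfolding v
    by (elim disjE; cases b;
        simp add: word_act_def rinf_op_def nth_append list_update_append)
qed

lemma far_commute_less:
  assumes "1 \<le> i" "i + 2 \<le> j" "j < length v"
  shows "word_act v [\<sigma> i, \<sigma> j] = word_act v [\<sigma> j, \<sigma> i]"
    "word_act v [\<tau> i, \<tau> j] = word_act v [\<tau> j, \<tau> i]"
    "word_act v [\<sigma> i, \<tau> j] = word_act v [\<tau> j, \<sigma> i]"
    "word_act v [\<tau> i, \<sigma> j] = word_act v [\<sigma> j, \<tau> i]"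
proof -
  obtain xs a b ys c d zs where "v = xs @ a # b # ys @ c # d # zs"
    "i = Suc (length xs)" "j = Suc (Suc (Suc (length xs + length ys)))"
    using split4[OF assms] by blast
  then show "word_act v [\<sigma> i, \<sigma> j] = word_act v [\<sigma> j, \<sigma> i]"
    "word_act v [\<tau> i, \<tau> j] = word_act v [\<tau> j, \<tau> i]"
    "word_act v [\<sigma> i, \<tau> j] = word_act v [\<tau> j, \<sigma> i]"
    "word_act v [\<tau> i, \<sigma> j] = word_act v [\<sigma> j, \<tau> i]"
    by (simp_all add: word_act_def nth_append list_update_append)
qed

lemma far_commute:
  assumes "i \<in> {1..<length v}" "j \<in> {1..<length v}" "i + 2 \<le> j \<or> j + 2 \<le> i"
  shows "word_act v [\<sigma> i, \<sigma> j] = word_act v [\<sigma> j, \<sigma> i]"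
    "word_act v [\<tau> i, \<tau> j] = word_act v [\<tau> j, \<tau> i]"
    "word_act v [\<sigma> i, \<tau> j] = word_act v [\<tau> j, \<sigma> i]"
  using assms far_commute_less[of i j v] far_commute_less[of j i v] by (auto simp del: One_nat_def)

lemma three_strands:
  assumes "1 \<le> i" "i + 1 < length v"
  shows "word_act v [\<sigma> i, \<sigma> (i+1), \<sigma> i] = word_act v [\<sigma> (i+1), \<sigma> i, \<sigma> (i+1)]"
    "word_act v [\<tau> i, \<tau> (i+1), \<tau> i] = word_act v [\<tau> (i+1), \<tau> i, \<tau> (i+1)]"
    "word_act v [\<tau> i, \<tau> (i+1), \<sigma> i] = word_act v [\<sigma> (i+1), \<tau> i, \<tau> (i+1)]"
proof -
  obtain xs a b c ys where "v = xs @ a # b # c # ys" "i = Suc (length xs)"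
    using split3[OF assms] by blast
  then show "word_act v [\<sigma> i, \<sigma> (i+1), \<sigma> i] = word_act v [\<sigma> (i+1), \<sigma> i, \<sigma> (i+1)]"
    "word_act v [\<tau> i, \<tau> (i+1), \<tau> i] = word_act v [\<tau> (i+1), \<tau> i, \<tau> (i+1)]"
    "word_act v [\<tau> i, \<tau> (i+1), \<sigma> i] = word_act v [\<sigma> (i+1), \<tau> i, \<tau> (i+1)]"
    by (simp_all add: word_act_def rinf_op_def nth_append list_update_append)
qed

lemma two_strands:
  assumes "i \<in> {1..<length v}"
  shows "word_act v [\<tau> i, \<tau> i] = word_act v []"
  using word_act_cancel[of "Tau_gen i" v False] assms
  by (simp add: VB_gens_def word_act_def)

lemma word_act_rels:
  assumes "(u, u') \<in> VB_rels (length v)"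
  shows "word_act v u = word_act v u'"
  using assms unfolding VB_rels_def
  apply -
  apply (elim UnE CollectE exE conjE Pair_inject; hypsubst)
        apply (rule three_strands far_commute two_strands; assumption)+
  done

lemma word_act_pres_eq:
  assumes "pres_eq (VB_gens m) (VB_rels m) u u'" "length v = m"
  shows "word_act v u = word_act v u'"
  using assms
proof (induction arbitrary: v rule: pres_eq.induct)
  case (rel u u')
  then show ?case using word_act_rels by blast
next
  case (cancel x b)
  then show ?case using word_act_cancel[of x v b] by (simp add: word_act_def)
next
  case (append u u' w w')
  then show ?case by (simp add: word_act_append)
qed auto

lemma hurwitz_act_class:
  assumes "u \<in> words (VB_gens m)" "length v = m"
  shows "v \<cdot> (pres_rel (VB_gens m) (VB_rels m) `` {u}) = word_act v u"
proof -
  have "u \<in> pres_rel (VB_gens m) (VB_rels m) `` {u}"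
    using assms by (simp add: pres_rel_def pres_eq.refl)
  moreover have "word_act v w = word_act v u"
    if "w \<in> pres_rel (VB_gens m) (VB_rels m) `` {u}" for w
    using that word_act_pres_eq[of m u w v] assms by (simp add: pres_rel_def)
  ultimately have "word_act v ` (pres_rel (VB_gens m) (VB_rels m) `` {u}) = {word_act v u}"
    by blast
  then show ?thesis by (simp add: hurwitz_act_def)
qed

lemma carrier_VB:
  "carrier (VB m) = (\<lambda>u. pres_rel (VB_gens m) (VB_rels m) `` {u}) ` words (VB_gens m)"
  by (auto simp: VB_def presented_group_def quotient_def)

lemma hurwitz_act_length:
  assumes "\<beta> \<in> carrier (VB m)" "length v = m"
  shows "length (v \<cdot> \<beta>) = m"
proof -
  obtain u where "u \<in> words (VB_gens m)" "\<beta> = pres_rel (VB_gens m) (VB_rels m) `` {u}"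
    using assms(1) unfolding carrier_VB by blast
  then show ?thesis
    using assms(2) by (simp add: hurwitz_act_class)
qed

lemma hurwitz_act_one:
  assumes "length v = m"
  shows "v \<cdot> \<one>\<^bsub>VB m\<^esub> = v"
proof -
  have "\<one>\<^bsub>VB m\<^esub> = pres_rel (VB_gens m) (VB_rels m) `` {[]}"
    by (simp add: VB_def presented_group_def)
  moreover have "word_act v [] = v"
    by (simp add: word_act_def)
  ultimately show ?thesis
    using hurwitz_act_class[of "[]" m v] assms by simp
qed

lemma hurwitz_act_mult:
  assumes "\<beta> \<in> carrier (VB m)" "\<gamma> \<in> carrier (VB m)" "length v = m"
  shows "v \<cdot> (\<beta> \<otimes>\<^bsub>VB m\<^esub> \<gamma>) = v \<cdot> \<beta> \<cdot> \<gamma>"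
proof -
  let ?C = "\<lambda>u. pres_rel (VB_gens m) (VB_rels m) `` {u}"
  obtain u u' where u: "u \<in> words (VB_gens m)" "\<beta> = ?C u" "u' \<in> words (VB_gens m)" "\<gamma> = ?C u'"
    using assms(1,2) unfolding carrier_VB by blast
  then have "\<beta> \<otimes>\<^bsub>VB m\<^esub> \<gamma> = ?C (u @ u')"
    by (simp add: VB_def presented_mult)
  then show ?thesis
    using u assms(3) by (simp add: hurwitz_act_class word_act_append)
qed


section \<open>The invariants\<close>

definition trivial_tuple :: "int list \<Rightarrow> bool"
  where "trivial_tuple v \<longleftrightarrow> (\<forall>a\<in>set v. \<forall>b\<in>set v. a = b)"

definition tuple_gcd :: "int list \<Rightarrow> int"
  where "tuple_gcd v = (if trivial_tuple v then 0 else Gcd {a - b | a b. a \<in> set v \<and> b \<in> set v})"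

text \<open>Congruence classes are sets of integers. As congruence modulo 0 is equality, the class of
  \<open>a\<close> is the singleton \<open>{a}\<close> for a trivial tuple; it stands for the integer \<open>a\<close> itself.\<close>

definition residue_class :: "int \<Rightarrow> int \<Rightarrow> int set"
  where "residue_class n a = {x. [x = a] (mod n)}"

definition tuple_classes :: "int list \<Rightarrow> int set multiset"
  where "tuple_classes v = image_mset (residue_class (2 * tuple_gcd v)) (mset v)"

lemma residue_class_0: "residue_class 0 a = {a}"
  by (auto simp: residue_class_def)

lemma tuple_gcd_pos:
  assumes "\<not> trivial_tuple v"
  shows "tuple_gcd v > 0"
proof -
  let ?D = "{a - b | a b. a \<in> set v \<and> b \<in> set v}"
  obtain a b where ab: "a \<in> set v" "b \<in> set v" "a \<noteq> b"
    using assms unfolding trivial_tuple_def by blast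
  have "Gcd ?D \<noteq> 0"
  proof
    assume "Gcd ?D = 0"
    moreover have "Gcd ?D dvd a - b"
      using ab by (intro Gcd_dvd) blast
    ultimately show False
      using ab(3) by (simp only: dvd_0_left_iff right_minus_eq)
  qed
  moreover have "Gcd ?D \<ge> 0"
    by (rule Gcd_int_greater_eq_0)
  ultimately show ?thesis
    using assms by (simp only: tuple_gcd_def if_False order_less_le) simp
qed

end

theory Submission
  imports Defs
begin

text \<open>Up to permutations, the Hurwitz action lets one reflect any entry of a tuple in any other
  entry. Reflecting all minimal (or all maximal) entries in an entry strictly between the minimum
  and the maximum keeps the tuple in its range and shrinks the range, so every nontrivial tuple
  \<open>v\<close> can be moved to one with set of entries \<open>{x, x + d}\<close>, where necessarily \<open>d = d(v)\<close>. Reflecting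
  all entries \<open>x\<close> in \<open>x + d\<close>, or conversely, shifts this window by \<open>d\<close>. Once the windows of two tuples
  agree, the residues modulo \<open>2d\<close> tell \<open>x\<close> and \<open>x + d\<close> apart, so that \<open>M\<close> determines the tuple up to
  order.\<close>

section \<open>Elementary moves on tuples and permutations\<close>

text \<open>\<open>swap\<close> is the virtual generator and \<open>reflect\<close> is \<sigma>
  followed by \<tau>, so that a reflection changes one entry and leaves the order alone.\<close>

inductive move :: "int list \<Rightarrow> int list \<Rightarrow> bool" where
  swap: "move (xs @ a # b # ys) (xs @ b # a # ys)"
| reflect: "move (xs @ a # b # ys) (xs @ (2 * b - a) # b # ys)"

abbreviation moves :: "int list \<Rightarrow> int list \<Rightarrow> bool"
  where "moves \<equiv> move\<^sup>*\<^sup>*"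

text \<open>Reflecting in \<open>b\<close> twice is the identity, so reachability by moves is
  symmetric without adding inverse moves.\<close>

lemma move_sym: "move v w \<Longrightarrow> move w v"
proof (induction rule: move.induct)
  case (reflect xs a b ys)
  show ?case using move.reflect[of xs "2 * b - a" b ys] by simp
qed (rule move.swap)

lemma moves_sym: "moves v w \<Longrightarrow> moves w v"
  by (rule sympD[OF symp_rtranclp[OF sympI]]) (rule move_sym)

lemma move_Cons: "move v w \<Longrightarrow> move (c # v) (c # w)"
proof (induction rule: move.induct)
  case (swap xs a b ys)
  show ?case using move.swap[of "c # xs" a b ys] by simp
next
  case (reflect xs a b ys)
  show ?case using move.reflect[of "c # xs" a b ys] by simp
qed

lemma moves_Cons: "moves v w \<Longrightarrow> moves (c # v) (c # w)"
  by (induction rule: rtranclp_induct) (simp, erule rtranclp.rtrancl_into_rtrancl, erule move_Cons)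

lemma moves_to_middle: "moves (a # xs @ ys) (xs @ a # ys)"
proof (induction xs)
  case (Cons c xs)
  have "move (a # c # xs @ ys) (c # a # xs @ ys)"
    using move.swap[of "[]"] by simp
  with moves_Cons[OF Cons.IH, of c] show ?case by simp
qed simp

text \<open>Adjacent swaps generate all permutations; from here on, tuples matter only as
  multisets.\<close>

lemma moves_mset: "mset v = mset w \<Longrightarrow> moves v w"
proof (induction v arbitrary: w)
  case (Cons a v)
  have "a \<in> set w" using Cons.prems by (metis list.set_intros(1) mset_eq_setD)
  then obtain xs ys where w: "w = xs @ a # ys" by (meson split_list)
  then have "moves v (xs @ ys)" using Cons by simp
  then have "moves (a # v) (a # xs @ ys)" by (rule moves_Cons)
  also have "moves (a # xs @ ys) w" unfolding w by (rule moves_to_middle)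
  finally show ?case .
qed simp

subsection \<open>Moves and braids\<close>

text \<open>A letter \<sigma> is a \<open>reflect\<close> followed by a \<open>swap\<close>, and its
  inverse is a \<open>swap\<close> followed by a \<open>reflect\<close>.\<close>

lemma moves_letter_act:
  assumes "fst l \<in> VB_gens (length v)"
  shows "moves v (letter_act v l)"
proof -
  obtain i where i: "1 \<le> i" "i < length v" "fst l = Sigma_gen i \<or> fst l = Tau_gen i"
    using assms by (auto simp: VB_gens_def)
  then obtain xs a b ys where v: "v = xs @ a # b # ys" "i = Suc (length xs)"
    using split2 by blast
  have tau: "moves (xs @ a # b # ys) (xs @ b # a # ys)"
    by (rule r_into_rtranclp) (rule move.swap)
  have "moves (xs @ a # b # ys) (xs @ (2 * b - a) # b # ys)"
    by (rule r_into_rtranclp) (rule move.reflect)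
  also have "move (xs @ (2 * b - a) # b # ys) (xs @ b # (2 * b - a) # ys)"
    by (rule move.swap)
  finally have sigma: "moves (xs @ a # b # ys) (xs @ b # (2 * b - a) # ys)" .
  have "move (xs @ b # a # ys) (xs @ (2 * a - b) # a # ys)"
    by (rule move.reflect)
  with tau have sigma_inv: "moves (xs @ a # b # ys) (xs @ (2 * a - b) # a # ys)"
    by (rule rtranclp.rtrancl_into_rtrancl)
  obtain x e where l: "l = (x, e)" by (cases l)
  then consider "l = (Sigma_gen i, False)" | "l = (Sigma_gen i, True)" | "l = (Tau_gen i, e)"
    using i(3) by (cases e) auto
  then show ?thesis
  proof cases
    case 1
    then show ?thesis using sigma v by (simp add: rinf_op_def nth_append list_update_append)
  next
    case 2
    then show ?thesis using sigma_inv v by (simp add: rinf_op_def nth_append list_update_append)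
  next
    case 3
    then show ?thesis using tau v by (simp add: nth_append list_update_append)
  qed
qed

lemma moves_word_act:
  "u \<in> words (VB_gens (length v)) \<Longrightarrow> moves v (word_act v u)"
proof (induction u arbitrary: v)
  case (Cons l u)
  then have "moves v (letter_act v l)" by (simp add: moves_letter_act)
  also have "moves (letter_act v l) (word_act (letter_act v l) u)" using Cons by simp
  finally show ?case by (simp add: word_act_def)
qed (simp add: word_act_def)

lemma move_imp_word:
  "move v w \<Longrightarrow> \<exists>u\<in>words (VB_gens (length v)). word_act v u = w"
proof (induction rule: move.induct)
  case (swap xs a b ys)
  show ?case
    by (rule bexI[of _ "[\<tau> (Suc (length xs))]"])
      (auto simp: VB_gens_def word_act_def nth_append list_update_append)
next
  case (reflect xs a b ys)
  \<comment> \<open>Here \<sigma> produces \<open>b\<close>, \<open>2 * b - a\<close> in this order,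
    and \<tau> exchanges the two.\<close>
  show ?case
    by (rule bexI[of _ "[\<sigma> (Suc (length xs)), \<tau> (Suc (length xs))]"])
      (auto simp: VB_gens_def word_act_def nth_append list_update_append rinf_op_def)
qed

lemma moves_imp_word:
  "moves v w \<Longrightarrow> \<exists>u\<in>words (VB_gens (length v)). word_act v u = w"
proof (induction rule: rtranclp_induct)
  case base
  show ?case by (rule bexI[of _ "[]"]) (auto simp: word_act_def)
next
  case (step y z)
  then obtain u where u: "u \<in> words (VB_gens (length v))" "word_act v u = y" by blast
  moreover obtain u' where "u' \<in> words (VB_gens (length v))" "word_act y u' = z"
    using move_imp_word[OF step.hyps(2)] u(2) by auto
  ultimately show ?case
    by (intro bexI[of _ "u @ u'"]) (auto simp: word_act_append)
qed

lemma hurwitz_orbit_iff_moves: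
  "(\<exists>\<beta>\<in>carrier (VB (length v)). v \<cdot> \<beta> = w) \<longleftrightarrow> moves v w"
proof -
  have "(\<exists>\<beta>\<in>carrier (VB (length v)). v \<cdot> \<beta> = w)
      \<longleftrightarrow> (\<exists>u\<in>words (VB_gens (length v)). word_act v u = w)"
    by (simp add: carrier_VB hurwitz_act_class)
  also have "\<dots> \<longleftrightarrow> moves v w"
    using moves_word_act[of _ v] moves_imp_word[of v w] by auto
  finally show ?thesis .
qed

subsection \<open>Invariance\<close>

lemma tuple_gcd_nonneg: "tuple_gcd v \<ge> 0"
  using tuple_gcd_pos[of v] by (cases "trivial_tuple v") (simp_all add: tuple_gcd_def)

text \<open>The universal property of the gcd also covers trivial tuples, where both sides hold for
  every \<open>n\<close>; this avoids later case distinctions.\<close>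

lemma dvd_tuple_gcd_iff:
  "n dvd tuple_gcd v \<longleftrightarrow> (\<forall>a\<in>set v. \<forall>b\<in>set v. n dvd a - b)"
proof (cases "trivial_tuple v")
  case True
  then show ?thesis
    by (simp add: tuple_gcd_def trivial_tuple_def) (metis diff_self dvd_0_right)
next
  case False
  then show ?thesis
    by (auto simp: tuple_gcd_def dvd_Gcd_iff)
qed

lemma tuple_gcd_dvd: "a \<in> set v \<Longrightarrow> b \<in> set v \<Longrightarrow> tuple_gcd v dvd a - b"
  using dvd_tuple_gcd_iff[THEN iffD1, OF dvd_refl] by blast

lemma tuple_gcd_dvd_move: "move v w \<Longrightarrow> tuple_gcd v dvd tuple_gcd w"
proof (induction rule: move.induct)
  case (swap xs a b ys)
  then show ?case by (auto simp: dvd_tuple_gcd_iff intro: tuple_gcd_dvd)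
next
  case (reflect xs a b ys)
  define d where "d = tuple_gcd (xs @ a # b # ys)"
  have d: "d dvd s - b" if "s \<in> set (xs @ a # b # ys)" for s
    unfolding d_def using that by (intro tuple_gcd_dvd) auto
  \<comment> \<open>All entries are compared with the pivot \<open>b\<close>: the reflection only
    changes the sign of \<open>a - b\<close>, and differences to \<open>b\<close> yield all
    others.\<close>
  have "d dvd s - b" if "s \<in> set (xs @ (2 * b - a) # b # ys)" for s
  proof (cases "s = 2 * b - a")
    case True
    then have "s - b = - (a - b)" by simp
    then show ?thesis using d[of a] by (simp only: dvd_minus_iff) simp
  qed (use d that in auto)
  then have "d dvd s - t" if "s \<in> set (xs @ (2 * b - a) # b # ys)"
    "t \<in> set (xs @ (2 * b - a) # b # ys)" for s t
    using dvd_diff[of d "s - b" "t - b"] that by simp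
  then show ?case unfolding d_def[symmetric] dvd_tuple_gcd_iff by blast
qed

lemma tuple_gcd_move: "move v w \<Longrightarrow> tuple_gcd v = tuple_gcd w"
  by (intro zdvd_antisym_nonneg tuple_gcd_nonneg) (erule tuple_gcd_dvd_move, erule tuple_gcd_dvd_move[OF move_sym])

lemma residue_class_eq_iff: "residue_class n a = residue_class n b \<longleftrightarrow> [a = b] (mod n)"
proof
  assume "residue_class n a = residue_class n b"
  then have "a \<in> residue_class n b" by (auto simp: residue_class_def)
  then show "[a = b] (mod n)" by (simp add: residue_class_def)
next
  assume "[a = b] (mod n)"
  then show "residue_class n a = residue_class n b" by (simp add: residue_class_def cong_def)
qed

text \<open>A reflection changes \<open>a\<close> by \<open>2 * (b - a)\<close>, and the gcd divides
  \<open>b - a\<close>: this is where the modulus \<open>2 * tuple_gcd v\<close> comes from.\<close>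

lemma tuple_classes_move: "move v w \<Longrightarrow> tuple_classes v = tuple_classes w"
\<comment> \<open>Equality of the gcds is kept as a premise, so that both sides use the same
  modulus.\<close>
proof (frule tuple_gcd_move, induction rule: move.induct)
  case (swap xs a b ys)
  then show ?case by (simp add: tuple_classes_def)
next
  case (reflect xs a b ys)
  have "tuple_gcd (xs @ a # b # ys) dvd a - b"
    by (rule tuple_gcd_dvd) auto
  then have "2 * tuple_gcd (xs @ a # b # ys) dvd 2 * (a - b)"
    by (rule mult_dvd_mono[OF dvd_refl])
  then have "[a = 2 * b - a] (mod 2 * tuple_gcd (xs @ a # b # ys))"
    by (simp add: cong_iff_dvd_diff algebra_simps)
  then show ?case
    using reflect by (simp add: tuple_classes_def residue_class_eq_iff)
qed

lemma moves_invariants: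
  "moves v w \<Longrightarrow> tuple_gcd v = tuple_gcd w \<and> tuple_classes v = tuple_classes w"
  by (induction rule: rtranclp_induct) (simp_all add: tuple_gcd_move tuple_classes_move)

subsection \<open>Reduction to two adjacent values\<close>

text \<open>The pivot \<open>b\<close> stays available: each entry in turn is brought in front of
  it, reflected or left alone, and then permuted back.\<close>

lemma moves_reflect_Cons:
  "(\<And>x. x \<in> set xs \<Longrightarrow> f x = x \<or> f x = 2 * b - x) \<Longrightarrow> moves (b # xs) (b # map f xs)"
proof (induction xs)
  case (Cons x xs)
  have "moves (b # x # xs) (x # b # xs)" by (rule moves_mset) simp
  also have "moves (x # b # xs) (f x # b # xs)"
    using Cons.prems[of x] move.reflect[of "[]" x b xs] by auto
  also have "moves (f x # b # xs) (f x # b # map f xs)"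
    by (rule moves_Cons, rule Cons.IH, rule Cons.prems) simp
  also have "moves (f x # b # map f xs) (b # map f (x # xs))" by (rule moves_mset) simp
  finally show ?case .
qed simp

lemma moves_reflect:
  assumes b: "b \<in> set v" and f: "\<And>x. x \<in> set v \<Longrightarrow> f x = x \<or> f x = 2 * b - x"
  shows "moves v (map f v)"
proof -
  obtain xs ys where v: "v = xs @ b # ys" using b by (meson split_list)
  have "f b = b" using f[OF b] by simp
  have "moves v (b # xs @ ys)" by (rule moves_mset) (simp add: v)
  also have "moves (b # xs @ ys) (b # map f (xs @ ys))"
    by (rule moves_reflect_Cons) (use f v in auto)
  also have "moves (b # map f (xs @ ys)) (map f v)"
    by (rule moves_mset) (simp add: v \<open>f b = b\<close>)
  finally show ?thesis .
qed

text \<open>Induction on the length of an enclosing interval. Its endpoints need not be entries, so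
  a reflection only has to clear one endpoint.\<close>

lemma moves_to_two_values:
  assumes "set v \<subseteq> {p..q}" "v \<noteq> []"
  shows "\<exists>w x y. moves v w \<and> set w = {x, y}"
  using assms
proof (induction "nat (q - p)" arbitrary: v p q rule: less_induct)
  case less
  show ?case
  proof (cases "set v \<subseteq> {p, q}")
    case True
    then have "set v \<in> Pow {p, q}" by (rule PowI)
    then have "set v = {p, p} \<or> set v = {q, q} \<or> set v = {p, q}"
      using less.prems(2) by (simp add: Pow_insert) argo
    then show ?thesis by (meson rtranclp.rtrancl_refl)
  next
    case False
    then obtain b where b: "b \<in> set v" "b \<noteq> p" "b \<noteq> q" by auto
    with less.prems(1) have b_between: "p < b" "b < q" by force+
    show ?thesis
    \<comment> \<open>With \<open>b\<close> in the lower half, the mirror image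
      \<open>2 * b - p\<close> lies above \<open>p\<close> and does not exceed \<open>q\<close>; in
      the upper half, \<open>q\<close> is reflected instead.\<close>
    proof (cases "2 * b \<le> p + q")
      case True
      define f where "f x = (if x = p then 2 * b - x else x)" for x
      have "moves v (map f v)" by (rule moves_reflect[OF b(1)]) (simp add: f_def)
      moreover have "set (map f v) \<subseteq> {p + 1..q}"
      proof
        fix y assume "y \<in> set (map f v)"
        then obtain x where "x \<in> set v" "y = f x" by auto
        moreover from this have "p \<le> x" "x \<le> q" using less.prems(1) by auto
        ultimately show "y \<in> {p + 1..q}" using b_between True by (auto simp: f_def)
      qed
      then have "\<exists>w x y. moves (map f v) w \<and> set w = {x, y}"
        using less.hyps[of q "p + 1" "map f v"] b_between less.prems(2) by simp
      ultimately show ?thesis by (meson rtranclp_trans)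
    next
      case False
      define f where "f x = (if x = q then 2 * b - x else x)" for x
      have "moves v (map f v)" by (rule moves_reflect[OF b(1)]) (simp add: f_def)
      moreover have "set (map f v) \<subseteq> {p..q - 1}"
      proof
        fix y assume "y \<in> set (map f v)"
        then obtain x where "x \<in> set v" "y = f x" by auto
        moreover from this have "p \<le> x" "x \<le> q" using less.prems(1) by auto
        ultimately show "y \<in> {p..q - 1}" using b_between False by (auto simp: f_def)
      qed
      then have "\<exists>w x y. moves (map f v) w \<and> set w = {x, y}"
        using less.hyps[of "q - 1" p "map f v"] b_between less.prems(2) by simp
      ultimately show ?thesis by (meson rtranclp_trans)
    qed
  qed
qed

lemma tuple_gcd_two_values:
  assumes "set w = {x, y}" "x \<le> y"
  shows "y = x + tuple_gcd w"
proof -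
  have "y - x dvd tuple_gcd w"
    using assms dvd_minus_iff[of "y - x" "y - x"] by (simp add: dvd_tuple_gcd_iff)
  moreover have "tuple_gcd w dvd y - x"
    using assms by (intro tuple_gcd_dvd) auto
  ultimately show ?thesis
    using zdvd_antisym_nonneg[of "y - x" "tuple_gcd w"] assms tuple_gcd_nonneg[of w] by simp
qed

text \<open>The gap between the two remaining values is their gcd, which moves preserve. For a
  trivial tuple the window is a single value.\<close>

lemma moves_to_window:
  assumes "v \<noteq> []"
  shows "\<exists>w x. moves v w \<and> set w = {x, x + tuple_gcd v}"
proof -
  have "set v \<subseteq> {Min (set v)..Max (set v)}" by auto
  from moves_to_two_values[OF this assms] obtain w x y where w: "moves v w" "set w = {x, y}"
    by blast
  then have gcd: "tuple_gcd v = tuple_gcd w" using moves_invariants by blast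
  show ?thesis
  proof (cases "x \<le> y")
    case True
    then show ?thesis using w tuple_gcd_two_values[of w x y] gcd by metis
  next
    case False
    then show ?thesis using w tuple_gcd_two_values[of w y x] gcd
      by (metis insert_commute linorder_le_cases)
  qed
qed

text \<open>Reflecting one end of the window in the other shifts it by \<open>d\<close>; the two
  induction steps go up and down.\<close>

lemma moves_shift_window:
  assumes "set v = {x, x + d}"
  shows "\<exists>w. moves v w \<and> set w = {x + k * d, x + k * d + d}"
proof (induction k rule: int_induct[where k = 0])
  case base
  show ?case using assms by auto
next
  case (step1 k)
  then obtain w where w: "moves v w" "set w = {x + k * d, x + k * d + d}" by blast
  \<comment> \<open>The lower end goes to \<open>x + (k + 2) * d\<close>, the upper end of the next
    window.\<close>
  define f where "f z = (if z = x + k * d then 2 * (x + k * d + d) - z else z)" for z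
  have "moves w (map f w)"
    by (rule moves_reflect[of "x + k * d + d"]) (simp_all add: f_def w)
  moreover have "set (map f w) = {x + (k + 1) * d, x + (k + 1) * d + d}"
    by (auto simp: w f_def algebra_simps)
  ultimately show ?case using w(1) by (meson rtranclp_trans)
next
  case (step2 k)
  then obtain w where w: "moves v w" "set w = {x + k * d, x + k * d + d}" by blast
  define f where "f z = (if z = x + k * d + d then 2 * (x + k * d) - z else z)" for z
  have "moves w (map f w)"
    by (rule moves_reflect[of "x + k * d"]) (simp_all add: f_def w)
  moreover have "set (map f w) = {x + (k - 1) * d, x + (k - 1) * d + d}"
    by (auto simp: w f_def algebra_simps)
  ultimately show ?case using w(1) by (meson rtranclp_trans)
qed

section \<open>Recovering a tuple up to order from its residue classes\<close>

text \<open>For nonzero \<open>d\<close>, the difference \<open>d\<close> is not a multiple of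
  \<open>2 * d\<close>; for \<open>d = 0\<close> the window is one point.\<close>

lemma residue_class_inj_on_window: "inj_on (residue_class (2 * d)) {x, x + d}"
proof (cases "d = 0")
  case False
  then have "\<not> 2 * d dvd d"
    using dvd_times_right_cancel_iff[of d 2 1] by simp
  then show ?thesis
    by (auto simp: inj_on_def residue_class_eq_iff cong_iff_dvd_diff)
qed simp

lemma image_mset_inj_on:
  assumes "image_mset f A = image_mset f B" "inj_on f (set_mset A \<union> set_mset B)"
  shows "A = B"
proof -
  define g where "g = the_inv_into (set_mset A \<union> set_mset B) f"
  have "image_mset (g \<circ> f) A = A" "image_mset (g \<circ> f) B = B"
    using assms(2) by (auto simp: g_def the_inv_into_f_f intro!: image_mset_cong[where g = id, simplified])
  then show ?thesis
    using assms(1) by (metis multiset.map_comp)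
qed

lemma moves_of_invariants:
  assumes "v \<noteq> []" and gcd: "tuple_gcd v = tuple_gcd w" and cl: "tuple_classes v = tuple_classes w"
  shows "moves v w"
proof -
  define d where "d = tuple_gcd v"
  have "w \<noteq> []" using cl assms(1) by (auto simp: tuple_classes_def)
  obtain v' x where v': "moves v v'" "set v' = {x, x + d}"
    using moves_to_window[OF assms(1)] d_def by blast
  obtain w' y where w': "moves w w'" "set w' = {y, y + d}"
    using moves_to_window[OF \<open>w \<noteq> []\<close>] gcd d_def by auto
  have gcd': "tuple_gcd v' = d" "tuple_gcd w' = d"
    using moves_invariants[OF v'(1)] moves_invariants[OF w'(1)] gcd d_def by auto
  have cl': "tuple_classes v' = tuple_classes w'"
    using moves_invariants[OF v'(1)] moves_invariants[OF w'(1)] cl by simp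
  \<comment> \<open>A class shared by both windows forces \<open>x\<close> and \<open>y\<close> to
    agree modulo \<open>d\<close>, so the windows differ by a multiple of \<open>d\<close>.\<close>
  have "residue_class (2 * d) x \<in># tuple_classes w'"
    unfolding cl'[symmetric] by (simp add: tuple_classes_def gcd' v')
  then have "[x = y] (mod 2 * d) \<or> [x = y + d] (mod 2 * d)"
    by (auto simp: tuple_classes_def gcd' w' residue_class_eq_iff)
  then have "d dvd x - y \<or> d dvd x - (y + d)"
    unfolding cong_iff_dvd_diff using dvd_mult_right by blast
  then have "d dvd x - y"
    by (metis add_diff_cancel_left diff_diff_eq dvd_add_left_iff dvd_refl diff_add_cancel)
  then obtain k where "x = y + k * d"
    by (metis add.commute diff_add_cancel dvdE mult.commute)
  then obtain w'' where w'': "moves w' w''" "set w'' = {x, x + d}"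
    using moves_shift_window[OF w'(2), of k] by auto
  have "tuple_gcd w'' = d" "tuple_classes v' = tuple_classes w''"
    using moves_invariants[OF w''(1)] gcd' cl' by auto
  \<comment> \<open>Both tuples now live on the same window, where classes modulo
    \<open>2 * d\<close> separate the values.\<close>
  then have "mset v' = mset w''"
    using residue_class_inj_on_window[of d x]
    by (intro image_mset_inj_on[of "residue_class (2 * d)"])
      (simp_all add: tuple_classes_def gcd' v' w'')
  then have "moves v' w''" by (rule moves_mset)
  \<comment> \<open>The path runs from \<open>v\<close> through \<open>v'\<close> to
    \<open>w''\<close>, then backwards through \<open>w'\<close> to \<open>w\<close>.\<close>
  then show ?thesis
    using v'(1) w'(1) w''(1) moves_sym by (meson rtranclp_trans)
qed

theorem theorem1p3:
  fixes m :: nat and v w :: "int list"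
  assumes "m \<ge> 2" and "length v = m" and "length w = m"
  shows "(\<exists>\<beta>\<in>carrier (VB m). v \<cdot> \<beta> = w) \<longleftrightarrow>
         tuple_gcd v = tuple_gcd w \<and> tuple_classes v = tuple_classes w"
proof -
  have "v \<noteq> []" using assms by auto
  then show ?thesis
    using hurwitz_orbit_iff_moves[of v w] moves_invariants moves_of_invariants assms(2) by blast
qed

end
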